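(* Let $V_1$ and $V_2$ be finite-dimensional vector spaces over a finite field $\mathbb{F}$ and let $U_1\subsetneq V_1$ and $U_2\subsetneq V_2$ be proper subspaces. Then the semigroups $L_{GL(U_1)}(V_1)$ and $L_{GL(U_2)}(V_2)$ are isomorphic if and only if there is a linear isomorphism $\phi:V_1\to V_2$ such that $U_1\phi=U_2$.
   Context: For a vector space $V$ and a subspace $U$ of $V$, $L_{GL(U)}(V)=\{\alpha\in L(V):\alpha|_U\in GL(U)\}$, where $L(V)$ is the semigroup of all linear maps $V\to V$ under composition and $GL(U)$ is the group of all bijective linear maps $U\to U$; $\alpha|_U\in GL(U)$ means that $\alpha$ restricts to a bijection of $U$ onto $U$. Maps are written on the right and composed from left to right; $U_1\phi$ is the image of $U_1$ under $\phi$. *)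

theory Defs
  imports "HOL.Vector_Spaces" "HOL-Algebra.Group"
begin

text \<open>
  The vector space V is the whole type \<open>'v\<close> with scalar multiplication \<open>s\<close>.
  Maps are written on the right, so the product \<open>\<alpha> \<beta>\<close> is "first \<open>\<alpha>\<close>, then \<open>\<beta>\<close>".
  The semigroup contains the identity map, which fills the \<open>one\<close> field; homomorphisms and
  isomorphisms (\<^const>\<open>hom\<close>, \<^const>\<open>iso\<close>, \<^const>\<open>is_iso\<close>) only refer to the carrier
  and the multiplication, so \<^const>\<open>is_iso\<close> is isomorphism of semigroups.
\<close>

definition L_GL :: "('f::field \<Rightarrow> 'v::ab_group_add \<Rightarrow> 'v) \<Rightarrow> 'v set \<Rightarrow> ('v \<Rightarrow> 'v) monoid" where
  "L_GL s U =
     \<lparr>carrier = {\<alpha>. Vector_Spaces.linear s s \<alpha> \<and> bij_betw \<alpha> U U},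
      mult = (\<lambda>\<alpha> \<beta>. \<beta> \<circ> \<alpha>),
      one = id\<rparr>"

end

theory Submission
  imports Defs "HOL-Library.Cardinality"
begin

text \<open>
  Let \<open>q\<close> be the size of the field, \<open>r = dim U\<close> and \<open>d = dim V - dim U\<close>. The projections onto \<open>U\<close>
  are the idempotents \<open>e\<close> with \<open>e f = e\<close> for every idempotent \<open>f\<close>, because every idempotent fixes
  \<open>U\<close> pointwise; there are \<open>q ^ (r d)\<close> of them. The maps that fix \<open>U\<close> pointwise are the \<open>a\<close> with
  \<open>e a = e\<close> for every projection \<open>e\<close> onto \<open>U\<close>; there are \<open>q ^ ((r + d) d)\<close> of them. The quotient
  \<open>q ^ d\<^sup>2\<close> determines \<open>d\<close>, and since \<open>d > 0\<close> the first count then determines \<open>r\<close>.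
\<close>

section \<open>Isomorphism invariants built from idempotents\<close>

definition absorbing_idempotents :: "('a, 'b) monoid_scheme \<Rightarrow> 'a set" where
  "absorbing_idempotents M =
     {e \<in> carrier M. e \<otimes>\<^bsub>M\<^esub> e = e \<and> (\<forall>f\<in>carrier M. f \<otimes>\<^bsub>M\<^esub> f = f \<longrightarrow> e \<otimes>\<^bsub>M\<^esub> f = e)}"

definition absorbed_elements :: "('a, 'b) monoid_scheme \<Rightarrow> 'a set" where
  "absorbed_elements M = {a \<in> carrier M. \<forall>e\<in>absorbing_idempotents M. e \<otimes>\<^bsub>M\<^esub> a = e}"

text \<open>Only the carrier and the multiplication enter the two sets. Injectivity makes
  \<open>h\<close> reflect equations between products, and surjectivity lets quantifiers over the
  carrier of \<open>N\<close> run over that of \<open>M\<close>. The second image needs the first,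
  since its quantifier ranges over absorbing idempotents.\<close>

lemma
  assumes "h \<in> iso M N"
    and closed: "\<And>x y. x \<in> carrier M \<Longrightarrow> y \<in> carrier M \<Longrightarrow> x \<otimes>\<^bsub>M\<^esub> y \<in> carrier M"
  shows iso_image_absorbing_idempotents:
      "h ` absorbing_idempotents M = absorbing_idempotents N"
    and iso_image_absorbed_elements:
      "h ` absorbed_elements M = absorbed_elements N"
proof -
  have mult: "h (x \<otimes>\<^bsub>M\<^esub> y) = h x \<otimes>\<^bsub>N\<^esub> h y" if "x \<in> carrier M" "y \<in> carrier M" for x y
    using assms(1) that by (simp add: iso_def hom_def)
  have inj: "inj_on h (carrier M)" and surj: "carrier N = h ` carrier M"
    using assms(1) by (auto simp: iso_def bij_betw_def)
  \<comment> \<open>Injectivity holds only on the carrier, so \<open>closed\<close> is what allows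
    it to be applied to the product of \<open>x\<close> and \<open>y\<close>.\<close>
  have eq: "h x \<otimes>\<^bsub>N\<^esub> h y = h z \<longleftrightarrow> x \<otimes>\<^bsub>M\<^esub> y = z"
    if "x \<in> carrier M" "y \<in> carrier M" "z \<in> carrier M" for x y z
    using that inj_on_eq_iff[OF inj closed] by (simp flip: mult)
  have iff1: "h e \<in> absorbing_idempotents N \<longleftrightarrow> e \<in> absorbing_idempotents M"
    if "e \<in> carrier M" for e
    using that by (simp add: absorbing_idempotents_def surj eq)
  have "absorbing_idempotents N \<subseteq> h ` carrier M" "absorbing_idempotents M \<subseteq> carrier M"
    using surj by (auto simp: absorbing_idempotents_def)
  with iff1 show idem: "h ` absorbing_idempotents M = absorbing_idempotents N"
    by blast
  have iff2: "h a \<in> absorbed_elements N \<longleftrightarrow> a \<in> absorbed_elements M"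
    if "a \<in> carrier M" for a
  proof -
    have "h e \<otimes>\<^bsub>N\<^esub> h a = h e \<longleftrightarrow> e \<otimes>\<^bsub>M\<^esub> a = e" if "e \<in> absorbing_idempotents M" for e
      using that \<open>a \<in> carrier M\<close> by (simp add: eq absorbing_idempotents_def)
    then show ?thesis
      using that by (simp add: absorbed_elements_def surj flip: idem)
  qed
  have "absorbed_elements N \<subseteq> h ` carrier M" "absorbed_elements M \<subseteq> carrier M"
    using surj by (auto simp: absorbed_elements_def)
  with iff2 show "h ` absorbed_elements M = absorbed_elements N"
    by blast
qed

lemma
  assumes "M \<cong> N"
    and "\<And>x y. x \<in> carrier M \<Longrightarrow> y \<in> carrier M \<Longrightarrow> x \<otimes>\<^bsub>M\<^esub> y \<in> carrier M"
  shows card_absorbing_idempotents_eq: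
      "card (absorbing_idempotents M) = card (absorbing_idempotents N)"
    and card_absorbed_elements_eq:
      "card (absorbed_elements M) = card (absorbed_elements N)"
proof -
  obtain h where h: "h \<in> iso M N"
    using assms(1) by (auto simp: is_iso_def)
  then have inj: "inj_on h (carrier M)"
    by (simp add: iso_def bij_betw_def)
  have "inj_on h (absorbing_idempotents M)" "inj_on h (absorbed_elements M)"
    by (auto intro: inj_on_subset[OF inj] simp: absorbing_idempotents_def absorbed_elements_def)
  then show "card (absorbing_idempotents M) = card (absorbing_idempotents N)"
    and "card (absorbed_elements M) = card (absorbed_elements N)"
    using iso_image_absorbing_idempotents[OF h assms(2)] iso_image_absorbed_elements[OF h assms(2)]
    by (metis card_image)+
qed

section \<open>The invariant sets of \<open>L_GL\<close> as sets of linear maps\<close>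

lemma L_GL_simps:
  "\<alpha> \<in> carrier (L_GL s U) \<longleftrightarrow> Vector_Spaces.linear s s \<alpha> \<and> bij_betw \<alpha> U U"
  "\<alpha> \<otimes>\<^bsub>L_GL s U\<^esub> \<beta> = \<beta> \<circ> \<alpha>"
  by (simp_all add: L_GL_def)

lemma L_GL_closed:
  "\<alpha> \<in> carrier (L_GL s U) \<Longrightarrow> \<beta> \<in> carrier (L_GL s U) \<Longrightarrow>
    \<alpha> \<otimes>\<^bsub>L_GL s U\<^esub> \<beta> \<in> carrier (L_GL s U)"
  by (auto simp: L_GL_simps intro: Vector_Spaces.linear_compose bij_betw_trans)

text \<open>Since \<open>f u\<close> stays in \<open>U\<close>, injectivity on \<open>U\<close>
  cancels one \<open>f\<close> from \<open>f (f u) = f u\<close>.\<close>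

lemma bij_betw_idempotent_fixes:
  assumes "bij_betw f U U" "f \<circ> f = f" "u \<in> U"
  shows "f u = u"
  using assms by (metis bij_betw_apply bij_betw_imp_inj_on comp_apply inj_on_eq_iff)

context vector_space
begin

text \<open>Some projection \<open>p\<close> onto \<open>U\<close> is itself an idempotent of the
  semigroup, and absorbing it means \<open>p \<circ> e = e\<close>, which forces the range of
  \<open>e\<close> into \<open>U\<close>. Conversely, every idempotent is the identity on
  \<open>U\<close>, so it changes nothing after a map with values in \<open>U\<close>.\<close>

lemma absorbing_idempotents_L_GL:
  assumes "subspace U"
  shows "absorbing_idempotents (L_GL scale U) =
    {\<alpha>. Vector_Spaces.linear scale scale \<alpha> \<and> (\<forall>u\<in>U. \<alpha> u = u) \<and> range \<alpha> \<subseteq> U}"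
    (is "?L = ?R")
proof
  interpret p: vector_space_pair scale scale ..
  \<comment> \<open>A linear left inverse of \<open>id\<close> on \<open>U\<close> with values in
    \<open>U\<close> is a projection onto \<open>U\<close>.\<close>
  obtain p where p: "range p \<subseteq> U" "Vector_Spaces.linear scale scale p" "\<forall>u\<in>U. p u = u"
    using p.linear_exists_left_inverse_on[OF linear_id assms] by auto
  have bij: "bij_betw \<alpha> U U" if "\<forall>u\<in>U. \<alpha> u = u" for \<alpha>
    using that by (auto simp: bij_betw_def inj_on_def)
  show "?L \<subseteq> ?R"
  proof
    fix e assume e: "e \<in> ?L"
    have "p \<circ> p = p"
      using p(1,3) by (auto simp: fun_eq_iff)
    then have pe: "p \<circ> e = e"
      using e p(2) bij[OF p(3)] by (simp add: absorbing_idempotents_def L_GL_simps)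
    have "range e \<subseteq> U"
      using p(1) by (subst pe[symmetric]) auto
    then show "e \<in> ?R"
      using e bij_betw_idempotent_fixes[of e U] by (auto simp: absorbing_idempotents_def L_GL_simps)
  qed
  show "?R \<subseteq> ?L"
  proof
    fix e assume e: "e \<in> ?R"
    have "f \<circ> e = e" if "bij_betw f U U" "f \<circ> f = f" for f
      using e bij_betw_idempotent_fixes[OF that] by (auto simp: fun_eq_iff image_subset_iff)
    moreover have "e \<circ> e = e"
      using e by (auto simp: fun_eq_iff)
    ultimately show "e \<in> ?L"
      using e bij[of e] by (simp add: absorbing_idempotents_def L_GL_simps)
  qed
qed

text \<open>A single projection \<open>p\<close> onto \<open>U\<close> already gives the forward
  inclusion: evaluating \<open>a \<circ> p = p\<close> at a point of \<open>U\<close> shows that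
  \<open>a\<close> fixes it. Conversely, absorbing idempotents take values in \<open>U\<close>,
  where \<open>a\<close> is the identity.\<close>

lemma absorbed_elements_L_GL:
  assumes "subspace U"
  shows "absorbed_elements (L_GL scale U) =
    {\<alpha>. Vector_Spaces.linear scale scale \<alpha> \<and> (\<forall>u\<in>U. \<alpha> u = u)}"
    (is "?L = ?R")
proof
  interpret p: vector_space_pair scale scale ..
  obtain p where p: "range p \<subseteq> U" "Vector_Spaces.linear scale scale p" "\<forall>u\<in>U. p u = u"
    using p.linear_exists_left_inverse_on[OF linear_id assms] by auto
  show "?L \<subseteq> ?R"
  proof
    fix a assume a: "a \<in> ?L"
    then have "a \<circ> p = p"
      using p by (simp add: absorbed_elements_def absorbing_idempotents_L_GL[OF assms] L_GL_simps)
    then have "a u = u" if "u \<in> U" for u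
      using p(3) that by (metis comp_apply)
    then show "a \<in> ?R"
      using a by (simp add: absorbed_elements_def L_GL_simps)
  qed
  show "?R \<subseteq> ?L"
  proof
    fix a assume a: "a \<in> ?R"
    then have "bij_betw a U U"
      by (auto simp: bij_betw_def inj_on_def)
    then show "a \<in> ?L"
      using a by (auto simp: absorbed_elements_def absorbing_idempotents_L_GL[OF assms]
          L_GL_simps fun_eq_iff image_subset_iff)
  qed
qed

section \<open>Counting linear maps by their values on a basis\<close>

lemma card_linear_fixing:
  assumes ind: "independent (A \<union> C)" and span: "span (A \<union> C) = UNIV"
    and disj: "A \<inter> C = {}" and fin: "finite C"
    and W: "subspace W" and sub: "span A \<subseteq> W"
  shows "card {\<alpha>. Vector_Spaces.linear scale scale \<alpha> \<and> (\<forall>u\<in>span A. \<alpha> u = u) \<and> range \<alpha> \<subseteq> W}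
    = card W ^ card C" (is "card ?S = _")
proof -
  interpret p: vector_space_pair scale scale ..
  \<comment> \<open>The values on \<open>A\<close> are forced, so a map in the set is determined by
    its values on \<open>C\<close>, and these can be any elements of \<open>W\<close>.\<close>
  have "bij_betw (\<lambda>\<alpha>. restrict \<alpha> C) ?S (C \<rightarrow>\<^sub>E W)"
    unfolding bij_betw_def
  proof
    show "inj_on (\<lambda>\<alpha>. restrict \<alpha> C) ?S"
    proof (rule inj_onI)
      fix \<alpha> \<beta> assume \<alpha>: "\<alpha> \<in> ?S" and \<beta>: "\<beta> \<in> ?S" and eq: "restrict \<alpha> C = restrict \<beta> C"
      have "\<alpha> x = \<beta> x" for x
      proof (rule p.linear_eq_on[of \<alpha> \<beta> x "A \<union> C"])
        fix b assume "b \<in> A \<union> C"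
        then show "\<alpha> b = \<beta> b"
          using \<alpha> \<beta> span_base[of b A] fun_cong[OF eq, of b] by auto
      qed (use \<alpha> \<beta> span in auto)
      then show "\<alpha> = \<beta>" by blast
    qed
    show "(\<lambda>\<alpha>. restrict \<alpha> C) ` ?S = C \<rightarrow>\<^sub>E W"
    proof
      show "(\<lambda>\<alpha>. restrict \<alpha> C) ` ?S \<subseteq> C \<rightarrow>\<^sub>E W" by auto
      show "C \<rightarrow>\<^sub>E W \<subseteq> (\<lambda>\<alpha>. restrict \<alpha> C) ` ?S"
      proof
        fix f assume f: "f \<in> C \<rightarrow>\<^sub>E W"
        \<comment> \<open>\<open>f\<close> prescribes the values on \<open>C\<close>; the identity
          supplies the forced values on \<open>A\<close>, which lie in \<open>W\<close> because
          \<open>span A\<close> does.\<close>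
        define g where "g x = (if x \<in> C then f x else x)" for x
        \<comment> \<open>This extension also controls the range: it is the span of the prescribed
          values, hence contained in the subspace \<open>W\<close>.\<close>
        obtain \<alpha> where \<alpha>: "Vector_Spaces.linear scale scale \<alpha>" "\<forall>x\<in>A \<union> C. \<alpha> x = g x"
            "range \<alpha> = span (g ` (A \<union> C))"
          using p.linear_independent_extend_subspace[OF ind, of g] by blast
        have "g ` (A \<union> C) \<subseteq> W"
          using f sub span_base[of _ A] by (auto simp: g_def)
        then have "range \<alpha> \<subseteq> W"
          unfolding \<alpha>(3) using W by (rule span_minimal)
        moreover have "\<alpha> b = b" if "b \<in> A" for b
          using that \<alpha>(2) disj by (auto simp: g_def)
        then have "\<alpha> u = u" if "u \<in> span A" for u
          using p.linear_eq_on[OF \<alpha>(1) linear_ident that] by blast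
        moreover have "restrict \<alpha> C = f"
          using f \<alpha>(2) by (auto simp: fun_eq_iff g_def PiE_def extensional_def)
        ultimately show "f \<in> (\<lambda>\<alpha>. restrict \<alpha> C) ` ?S"
          using \<alpha>(1) by blast
      qed
    qed
  qed
  then show ?thesis
    using fin by (simp add: bij_betw_same_card card_funcsetE)
qed

text \<open>Coordinates with respect to \<open>B\<close> identify the span with functions from
  \<open>B\<close> to the field, taken extensional so that each vector has exactly one coordinate
  function.\<close>

lemma card_span_independent:
  assumes ind: "independent B" and fin: "finite B"
  shows "card (span B) = CARD('a) ^ card B"
proof -
  have "bij_betw (\<lambda>f. \<Sum>b\<in>B. scale (f b) b) (B \<rightarrow>\<^sub>E UNIV) (span B)"
    unfolding bij_betw_def
  proof
    show "inj_on (\<lambda>f. \<Sum>b\<in>B. scale (f b) b) (B \<rightarrow>\<^sub>E UNIV)"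
    proof (rule inj_onI)
      fix f g :: "'b \<Rightarrow> 'a"
      assume f: "f \<in> B \<rightarrow>\<^sub>E UNIV" and g: "g \<in> B \<rightarrow>\<^sub>E UNIV"
        and eq: "(\<Sum>b\<in>B. scale (f b) b) = (\<Sum>b\<in>B. scale (g b) b)"
      have "(\<Sum>b\<in>B. scale (f b - g b) b) = 0"
        using eq by (simp add: scale_left_diff_distrib sum_subtractf)
      then have "f b - g b = 0" if "b \<in> B" for b
        using independentD[OF ind fin subset_refl _ that, of "\<lambda>b. f b - g b"] by simp
      then show "f = g"
        using f g by (intro PiE_ext) auto
    qed
    show "(\<lambda>f. \<Sum>b\<in>B. scale (f b) b) ` (B \<rightarrow>\<^sub>E UNIV) = span B"
    proof -
      \<comment> \<open>\<open>span_finite\<close> allows arbitrary coefficient functions;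
        restricting one to \<open>B\<close> makes it extensional and keeps the sum.\<close>
      have "(\<Sum>b\<in>B. scale (f b) b) \<in> (\<lambda>f. \<Sum>b\<in>B. scale (f b) b) ` (B \<rightarrow>\<^sub>E UNIV)" for f
        by (rule image_eqI[of _ _ "restrict f B"]) auto
      then show ?thesis
        unfolding span_finite[OF fin] by auto
    qed
  qed
  then show ?thesis
    using fin by (simp add: card_funcsetE flip: bij_betw_same_card)
qed

end

text \<open>A basis \<open>A\<close> of \<open>U\<close> is extended to a basis of the whole space,
  and \<open>C\<close> collects the added vectors. Thus \<open>card C\<close> is the codimension of
  \<open>U\<close>.\<close>

lemma (in finite_dimensional_vector_space) adapted_basis:
  assumes "subspace U"
  obtains A C where "independent (A \<union> C)" "span (A \<union> C) = UNIV" "A \<inter> C = {}"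
    "finite A" "finite C" "span A = U"
proof -
  obtain A where A: "A \<subseteq> U" "independent A" "U \<subseteq> span A"
    by (rule basis_exists)
  obtain B where B: "A \<subseteq> B" "independent B" "UNIV \<subseteq> span B"
    by (rule maximal_independent_subset_extend[OF subset_UNIV A(2)])
  have "A \<union> (B - A) = B" using B(1) by blast
  moreover have "span A = U"
    using span_minimal[OF A(1) assms] A(3) by blast
  ultimately show thesis
    using that[of A "B - A"] A B finiteI_independent by auto
qed

text \<open>Both counts are instances of \<open>card_linear_fixing\<close>: the target
  \<open>W\<close> is \<open>span A\<close> for the projections and the whole space for the maps
  fixing \<open>span A\<close> pointwise.\<close>

lemma card_absorbing_L_GL:
  fixes s :: "'f::{field,finite} \<Rightarrow> 'v::ab_group_add \<Rightarrow> 'v"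
  assumes "vector_space s"
    and ind: "\<not> module.dependent s (A \<union> C)" and span: "module.span s (A \<union> C) = UNIV"
    and disj: "A \<inter> C = {}" and fin: "finite A" "finite C"
  shows "card (absorbing_idempotents (L_GL s (module.span s A))) =
      CARD('f) ^ (card A * card C)"
    and "card (absorbed_elements (L_GL s (module.span s A))) =
      CARD('f) ^ ((card A + card C) * card C)"
proof -
  interpret vector_space s by fact
  have "card (span A) = CARD('f) ^ card A"
    using card_span_independent[of A] independent_mono[OF ind] fin by auto
  then show "card (absorbing_idempotents (L_GL s (span A))) = CARD('f) ^ (card A * card C)"
    using card_linear_fixing[OF ind span disj fin(2) subspace_span subset_refl]
    by (simp add: absorbing_idempotents_L_GL power_mult)
  have "card (UNIV :: 'v set) = CARD('f) ^ (card A + card C)"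
    using card_span_independent[OF ind] fin disj span by (simp add: card_Un_disjoint)
  then show "card (absorbed_elements (L_GL s (span A))) = CARD('f) ^ ((card A + card C) * card C)"
    using card_linear_fixing[OF ind span disj fin(2) subspace_UNIV subset_UNIV]
    by (simp add: absorbed_elements_L_GL power_mult)
qed

section \<open>From equal counts to a linear isomorphism\<close>

lemma products_determine_summands:
  fixes r1 d1 r2 d2 :: nat
  assumes "r1 * d1 = r2 * d2" "(r1 + d1) * d1 = (r2 + d2) * d2" "d1 > 0"
  shows "r1 = r2 \<and> d1 = d2"
proof -
  \<comment> \<open>Subtracting the first equation from the second leaves only the squares.\<close>
  have "d1\<^sup>2 = d2\<^sup>2"
    using assms(1,2) by (simp add: algebra_simps power2_eq_square)
  then have "d1 = d2" by simp
  \<comment> \<open>Positivity of \<open>d1\<close> permits cancelling it from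
    \<open>r1 * d1 = r2 * d1\<close>; for \<open>d1 = 0\<close> both products vanish and
    \<open>r1\<close> would be undetermined.\<close>
  then show ?thesis using assms(1,3) by simp
qed

text \<open>Matching \<open>A1\<close> with \<open>A2\<close> and \<open>C1\<close> with
  \<open>C2\<close> separately gives a bijection of bases whose linear extension respects the
  subspaces as well as the whole spaces.\<close>

lemma linear_iso_of_adapted_bases:
  fixes s1 :: "'f::field \<Rightarrow> 'v::ab_group_add \<Rightarrow> 'v"
    and s2 :: "'f \<Rightarrow> 'w::ab_group_add \<Rightarrow> 'w"
  assumes "vector_space s1" "vector_space s2"
    and 1: "\<not> module.dependent s1 (A1 \<union> C1)" "module.span s1 (A1 \<union> C1) = UNIV"
      "A1 \<inter> C1 = {}" "finite A1" "finite C1"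
    and 2: "\<not> module.dependent s2 (A2 \<union> C2)" "module.span s2 (A2 \<union> C2) = UNIV"
      "A2 \<inter> C2 = {}" "finite A2" "finite C2"
    and card: "card A1 = card A2" "card C1 = card C2"
  shows "\<exists>\<phi>. Vector_Spaces.linear s1 s2 \<phi> \<and> bij \<phi> \<and> \<phi> ` module.span s1 A1 = module.span s2 A2"
proof -
  interpret p: vector_space_pair s1 s2
    using assms(1,2) by (simp add: vector_space_pair_def)
  obtain g h where g: "bij_betw g A1 A2" and h: "bij_betw h C1 C2"
    using card 1(4,5) 2(4,5) by (metis bij_betw_iff_card)
  define k where "k x = (if x \<in> A1 then g x else h x)" for x
  have kA: "bij_betw k A1 A2"
    using g by (rule bij_betw_cong[THEN iffD1, rotated]) (simp add: k_def)
  have "bij_betw k C1 C2"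
    using h by (rule bij_betw_cong[THEN iffD1, rotated]) (use 1(3) in \<open>auto simp: k_def\<close>)
  with kA have k: "bij_betw k (A1 \<union> C1) (A2 \<union> C2)"
    using 2(3) by (rule bij_betw_combine)
  obtain \<phi> where \<phi>: "Vector_Spaces.linear s1 s2 \<phi>" "\<forall>x\<in>A1 \<union> C1. \<phi> x = k x"
    using p.linear_independent_extend[OF 1(1)] by blast
  have bij: "bij_betw \<phi> (A1 \<union> C1) (A2 \<union> C2)"
    using k by (rule bij_betw_cong[THEN iffD1, rotated]) (use \<phi>(2) in auto)
  have image: "\<phi> ` (A1 \<union> C1) = A2 \<union> C2" "\<phi> ` A1 = A2"
    using bij kA \<phi>(2) by (auto simp: bij_betw_def)
  \<comment> \<open>A linear map that sends a basis injectively to an independent set is injective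
    on its span.\<close>
  have "inj_on \<phi> (p.vs1.span (A1 \<union> C1))"
    using bij 2(1) image by (intro p.linear_inj_on_span_independent_image[OF \<phi>(1)])
      (auto simp: bij_betw_def)
  moreover have "\<phi> ` p.vs1.span (A1 \<union> C1) = p.vs2.span (A2 \<union> C2)"
    using p.linear_span_image[OF \<phi>(1)] image(1) by metis
  ultimately have "bij \<phi>"
    using 1(2) 2(2) by (simp add: bij_betw_def)
  moreover have "\<phi> ` p.vs1.span A1 = p.vs2.span A2"
    using p.linear_span_image[OF \<phi>(1)] image(2) by metis
  ultimately show ?thesis using \<phi>(1) by blast
qed

section \<open>Conjugation by a linear isomorphism\<close>

lemma linear_inv:
  assumes "Vector_Spaces.linear s1 s2 \<phi>" "bij \<phi>"
  shows "Vector_Spaces.linear s2 s1 (inv_into UNIV \<phi>)"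
proof -
  interpret linear s1 s2 \<phi> by fact
  interpret p: vector_space_pair s1 s2 ..
  obtain g where "Vector_Spaces.linear s2 s1 g" "g \<circ> \<phi> = id"
    using p.linear_injective_left_inverse[OF assms(1)] assms(2) by (auto simp: bij_def)
  \<comment> \<open>Surjectivity of \<open>\<phi>\<close> turns the linear left inverse
    \<open>g\<close> into the two-sided inverse.\<close>
  moreover from this(2) have "inv_into UNIV \<phi> = g"
    using assms(2) by (metis bij_is_surj comp_assoc comp_id id_comp surj_iff)
  ultimately show ?thesis by simp
qed

lemma conjugate_in_L_GL:
  assumes "Vector_Spaces.linear s1 s2 \<phi>" "bij \<phi>" "\<alpha> \<in> carrier (L_GL s1 U)"
  shows "\<phi> \<circ> \<alpha> \<circ> inv_into UNIV \<phi> \<in> carrier (L_GL s2 (\<phi> ` U))"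
proof -
  have "bij_betw \<phi> U (\<phi> ` U)"
    using assms(2) by (simp add: bij_betw_def inj_on_def)
  moreover have "bij_betw (inv_into UNIV \<phi>) (\<phi> ` U) U"
    using assms(2) by (metis bij_betw_inv_into_subset bij_betw_imp_surj_on bij_betw_subset subset_UNIV)
  ultimately have "bij_betw (\<phi> \<circ> \<alpha> \<circ> inv_into UNIV \<phi>) (\<phi> ` U) (\<phi> ` U)"
    using assms(3) by (auto simp: L_GL_simps intro: bij_betw_trans)
  moreover have "Vector_Spaces.linear s2 s2 (\<phi> \<circ> \<alpha> \<circ> inv_into UNIV \<phi>)"
    using assms linear_inv[OF assms(1,2)]
    by (auto simp: L_GL_simps intro: Vector_Spaces.linear_compose)
  ultimately show ?thesis by (simp add: L_GL_simps)
qed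

text \<open>The isomorphism is conjugation by \<open>\<phi>\<close>, and conjugation by the inverse
  of \<open>\<phi>\<close> undoes it. In a product of conjugates the inner factors
  \<open>\<phi>\<close> and its inverse cancel.\<close>

lemma L_GL_iso_of_linear_iso:
  assumes "Vector_Spaces.linear s1 s2 \<phi>" "bij \<phi>"
  shows "L_GL s1 U \<cong> L_GL s2 (\<phi> ` U)"
proof (rule is_isoI, rule isoI)
  let ?h = "\<lambda>\<alpha>. \<phi> \<circ> \<alpha> \<circ> inv_into UNIV \<phi>"
  have inv: "inv_into UNIV \<phi> (\<phi> x) = x" "\<phi> (inv_into UNIV \<phi> y) = y" for x y
    using assms(2) by (simp_all add: bij_is_inj bij_is_surj surj_f_inv_f)
  show "?h \<in> hom (L_GL s1 U) (L_GL s2 (\<phi> ` U))"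
    using conjugate_in_L_GL[OF assms] by (auto simp: hom_def L_GL_simps(2) fun_eq_iff inv)
  \<comment> \<open>This is \<open>conjugate_in_L_GL\<close> for the inverse of
    \<open>\<phi>\<close>, which carries the image of \<open>U\<close> back to
    \<open>U\<close>.\<close>
  have "inv_into UNIV \<phi> \<circ> \<beta> \<circ> \<phi> \<in> carrier (L_GL s1 U)" if "\<beta> \<in> carrier (L_GL s2 (\<phi> ` U))" for \<beta>
    using conjugate_in_L_GL[OF linear_inv[OF assms] bij_imp_bij_inv[OF assms(2)] that] assms(2)
    by (simp add: inv_inv_eq image_comp inv o_def)
  then show "bij_betw ?h (carrier (L_GL s1 U)) (carrier (L_GL s2 (\<phi> ` U)))"
    using conjugate_in_L_GL[OF assms]
    by (intro bij_betw_byWitness[where f' = "\<lambda>\<beta>. inv_into UNIV \<phi> \<circ> \<beta> \<circ> \<phi>"]) (auto simp: fun_eq_iff inv)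
qed

section \<open>Semigroup isomorphism versus linear isomorphism\<close>

theorem theorem4p4:
  fixes s1 :: "'f::{field,finite} \<Rightarrow> 'v::ab_group_add \<Rightarrow> 'v"
    and s2 :: "'f \<Rightarrow> 'w::ab_group_add \<Rightarrow> 'w"
    and B1 U1 :: "'v set"
    and B2 U2 :: "'w set"
  assumes "finite_dimensional_vector_space s1 B1"
    and "finite_dimensional_vector_space s2 B2"
    and "module.subspace s1 U1" and "U1 \<subset> UNIV"
    and "module.subspace s2 U2" and "U2 \<subset> UNIV"
  shows "L_GL s1 U1 \<cong> L_GL s2 U2 \<longleftrightarrow>
    (\<exists>\<phi>. Vector_Spaces.linear s1 s2 \<phi> \<and> bij \<phi> \<and> \<phi> ` U1 = U2)"
proof
  assume iso: "L_GL s1 U1 \<cong> L_GL s2 U2"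
  interpret V1: finite_dimensional_vector_space s1 B1 by fact
  interpret V2: finite_dimensional_vector_space s2 B2 by fact
  obtain A1 C1 where 1: "V1.independent (A1 \<union> C1)" "V1.span (A1 \<union> C1) = UNIV" "A1 \<inter> C1 = {}"
      "finite A1" "finite C1" and U1: "V1.span A1 = U1"
    using V1.adapted_basis[OF assms(3)] by blast
  obtain A2 C2 where 2: "V2.independent (A2 \<union> C2)" "V2.span (A2 \<union> C2) = UNIV" "A2 \<inter> C2 = {}"
      "finite A2" "finite C2" and U2: "V2.span A2 = U2"
    using V2.adapted_basis[OF assms(5)] by blast
  \<comment> \<open>Since 0 and 1 differ in a field, its size exceeds 1, so equal powers of it have
    equal exponents.\<close>
  have "card {0, 1 :: 'f} \<le> CARD('f)"
    by (rule card_mono) auto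
  then have q: "1 < CARD('f)" by simp
  note cards = card_absorbing_L_GL[OF V1.vector_space_axioms 1, unfolded U1]
    card_absorbing_L_GL[OF V2.vector_space_axioms 2, unfolded U2]
  have "card A1 * card C1 = card A2 * card C2"
    using card_absorbing_idempotents_eq[OF iso L_GL_closed] cards q by simp
  moreover have "(card A1 + card C1) * card C1 = (card A2 + card C2) * card C2"
    using card_absorbed_elements_eq[OF iso L_GL_closed] cards q by simp
  \<comment> \<open>Properness of \<open>U1\<close> enters here: with \<open>C1\<close> empty,
    \<open>A1\<close> would span the whole space.\<close>
  moreover have "C1 \<noteq> {}"
    using 1(2) U1 assms(4) by auto
  then have "card C1 > 0"
    using 1(5) by (simp add: card_gt_0_iff)
  ultimately have "card A1 = card A2 \<and> card C1 = card C2"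
    by (rule products_determine_summands)
  then show "\<exists>\<phi>. Vector_Spaces.linear s1 s2 \<phi> \<and> bij \<phi> \<and> \<phi> ` U1 = U2"
    using linear_iso_of_adapted_bases[OF V1.vector_space_axioms V2.vector_space_axioms 1 2] U1 U2
    by simp
next
  assume "\<exists>\<phi>. Vector_Spaces.linear s1 s2 \<phi> \<and> bij \<phi> \<and> \<phi> ` U1 = U2"
  then show "L_GL s1 U1 \<cong> L_GL s2 U2"
    using L_GL_iso_of_linear_iso by blast
qed

end
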